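(* Let $G$ be a finitely generated infinite group with finite generating set $A$, let $S=A\cup A^{-1}$, and suppose $G$ is not automatic. If $G$ has a Cayley automatic representation $\psi:L\to G$, $L\subseteq S^*$, whose Cayley distance function $h$ satisfies $h\ll\mathfrak i$, then there exists a quasigeodesic normal form $L'\subseteq S^*$ of $G$ that satisfies the $h(n)$-fellow traveler property.
   Context: Setting. $A=\{a_1,\dots,a_m\}$ is a finite set of symbols representing elements generating $G$; distinct symbols may represent equal elements and some may represent the identity $e$. $A^{-1}$ is the set of formal inverses and $S=A\cup A^{-1}$. $S^*$ is the set of finite words over $S$, $|w|$ is the length of $w$, and $\pi:S^*\to G$ is the canonical projection (evaluation) map. $d_A(g_1,g_2)$ is the length of a shortest word $u\in S^*$ with $\pi(u)=g_1^{-1}g_2$, and $d_A(g)=d_A(e,g)$. Normal form. A language $L\subseteq S^*$ defines a normal form of $G$ if the restriction $\pi|_L:L\to G$ is a bijection. Quasigeodesic. A normal form $L$ is quasigeodesic if there is a constant $C>0$ such that $|w|\leqslant C(d_A(\pi(w))+1)$ for every $w\in L$. Functions. $\mathbb N$ includes $0$; $[N,+\infty)=\{n\in\mathbb N: n\geqslant N\}$; $\mathbb R_+=\{x\in\mathbb R: x\geqslant 0\}$. $\mathcal F$ is the set of all nondecreasing functions $[N,+\infty)\to\mathbb R_+$, for any $N\in\mathbb N$. For $f,h\in\mathcal F$, $h\preceq f$ means there exist positive integers $K,M$ and a nonnegative integer $N$ such that $h(n)\leqslant Kf(Mn)$ for all $n\in[N,+\infty)$. $h\ll f$ means there is an unbounded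 $t\in\mathcal F$ with $ht\preceq f$ (pointwise product on the common domain). $\mathfrak i(n)=n$. Fellow traveler property. For a word $w$ and $t\in\mathbb N$, $w(t)$ is the prefix of $w$ of length $t$ if $t\leqslant|w|$, and $w(t)=w$ if $t>|w|$. For a normal form $L$ put $$s(n)=\max\{d_A(\pi(w_1(t)),\pi(w_2(t))) : t\in\mathbb N,\ t\leqslant n,\ w_1,w_2\in L,\ a\in A,\ \pi(w_1)a=\pi(w_2)\}.$$ For $f\in\mathcal F$ with $f\ll\mathfrak i$, $L$ satisfies the $f(n)$-fellow traveler property if $s\preceq f$. Automatic and Cayley automatic. A binary relation on $S^*$ is recognized by a two-tape synchronous automaton if the set of convolutions of its pairs (the two words are read in parallel letter by letter, the shorter one padded at the end by a special padding symbol) is a regular language. $G$ is automatic if it admits a normal form $L\subseteq S^*$ such that $L$ is regular and for each $a\in A$ the relation $\{(u,v)\in L\times L:\pi(u)a=\pi(v)\}$ is recognized by a two-tape synchronous automaton. A Cayley automatic representation of $G$ is a bijection $\psi:L\to G$ from a regular language $L\subseteq S^*$ such that for each $a\in A$ the relation $\{(u_1,u_2)\in L\times L:\psi(u_1)a=\psi(u_2)\}$ is recognized by a two-tape synchronous automaton. Cayley distance function. For a bijection $\psi:L\to G$ with $L\subseteq S^*$, let $L^{\leqslant n}$ be the set of words in $L$ of length at most $n$. The Cayley distance function $h:\mathbb N\to\mathbb R_+$ is $h(n)=\max\{d_A(\psi(w),\pi(w)): w\in L^{\leqslant n}\}$ if $L^{\leqslant n}\neq\varnothing$, and $h(n)=0$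 otherwise. *)

theory Defs
  imports Complex_Main "HOL-Algebra.Generated_Groups"
begin

section \<open>Regular languages and synchronous automata\<close>

text \<open>Deterministic finite automata over the alphabet \<open>\<Sigma>\<close>; taking the states to be
  natural numbers is no restriction. The transition function is only constrained on \<open>Q\<close> and \<open>\<Sigma>\<close>.\<close>

definition regular_language :: "'b set \<Rightarrow> 'b list set \<Rightarrow> bool" where
  "regular_language \<Sigma> L \<longleftrightarrow>
     (\<exists>(Q :: nat set) q0 F \<delta>. finite Q \<and> q0 \<in> Q \<and> F \<subseteq> Q \<and>
        (\<forall>q\<in>Q. \<forall>x\<in>\<Sigma>. \<delta> q x \<in> Q) \<and>
        L = {w \<in> lists \<Sigma>. foldl \<delta> q0 w \<in> F})"

text \<open>The padding symbol is \<open>None\<close>.\<close>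

fun convolution :: "'b list \<Rightarrow> 'b list \<Rightarrow> ('b option \<times> 'b option) list" where
  "convolution [] [] = []"
| "convolution (x # xs) [] = (Some x, None) # convolution xs []"
| "convolution [] (y # ys) = (None, Some y) # convolution [] ys"
| "convolution (x # xs) (y # ys) = (Some x, Some y) # convolution xs ys"

definition padded_pairs :: "'b set \<Rightarrow> ('b option \<times> 'b option) set" where
  "padded_pairs \<Sigma> = (insert None (Some ` \<Sigma>) \<times> insert None (Some ` \<Sigma>)) - {(None, None)}"

definition synchronously_recognized :: "'b set \<Rightarrow> ('b list \<times> 'b list) set \<Rightarrow> bool" where
  "synchronously_recognized \<Sigma> R \<longleftrightarrow>
     regular_language (padded_pairs \<Sigma>) {convolution u v | u v. (u, v) \<in> R}"

section \<open>Words, evaluation and word metric\<close>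

text \<open>\<open>A\<close> is a set of symbols and \<open>\<iota>\<close> sends a symbol to the group element it represents;
  \<open>\<iota>\<close> need not be injective and may take the value \<open>\<one>\<close>.\<close>

datatype 's letter = Gen 's | Inv 's

definition letters :: "'s set \<Rightarrow> 's letter set" where
  "letters A = Gen ` A \<union> Inv ` A"

fun eval_letter :: "('g, 'm) monoid_scheme \<Rightarrow> ('s \<Rightarrow> 'g) \<Rightarrow> 's letter \<Rightarrow> 'g" where
  "eval_letter G \<iota> (Gen a) = \<iota> a"
| "eval_letter G \<iota> (Inv a) = inv\<^bsub>G\<^esub> (\<iota> a)"

definition eval_word :: "('g, 'm) monoid_scheme \<Rightarrow> ('s \<Rightarrow> 'g) \<Rightarrow> 's letter list \<Rightarrow> 'g" where
  "eval_word G \<iota> w = foldr (\<lambda>x g. eval_letter G \<iota> x \<otimes>\<^bsub>G\<^esub> g) w \<one>\<^bsub>G\<^esub>"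

definition word_dist ::
    "('g, 'm) monoid_scheme \<Rightarrow> 's set \<Rightarrow> ('s \<Rightarrow> 'g) \<Rightarrow> 'g \<Rightarrow> 'g \<Rightarrow> nat" where
  "word_dist G A \<iota> g1 g2 =
     (LEAST n. \<exists>u \<in> lists (letters A). length u = n \<and> eval_word G \<iota> u = inv\<^bsub>G\<^esub> g1 \<otimes>\<^bsub>G\<^esub> g2)"

definition normal_form ::
    "('g, 'm) monoid_scheme \<Rightarrow> 's set \<Rightarrow> ('s \<Rightarrow> 'g) \<Rightarrow> 's letter list set \<Rightarrow> bool" where
  "normal_form G A \<iota> L \<longleftrightarrow> L \<subseteq> lists (letters A) \<and> bij_betw (eval_word G \<iota>) L (carrier G)"

definition quasigeodesic ::
    "('g, 'm) monoid_scheme \<Rightarrow> 's set \<Rightarrow> ('s \<Rightarrow> 'g) \<Rightarrow> 's letter list set \<Rightarrow> bool" where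
  "quasigeodesic G A \<iota> L \<longleftrightarrow>
     (\<exists>C::real. C > 0 \<and>
        (\<forall>w\<in>L. real (length w) \<le> C * (real (word_dist G A \<iota> \<one>\<^bsub>G\<^esub> (eval_word G \<iota> w)) + 1)))"

section \<open>Comparison of growth\<close>

text \<open>A partial function on \<open>[N, \<infinity>)\<close> is represented by a total function whose values below
  \<open>N\<close> are irrelevant. The two comparisons below do not see these values, since the threshold
  in \<open>\<preceq>\<close> can always be enlarged.\<close>

definition growth_functions :: "nat \<Rightarrow> (nat \<Rightarrow> real) set" where
  "growth_functions N = {f. mono_on {N..} f \<and> (\<forall>n\<ge>N. 0 \<le> f n)}"

definition growth_le :: "(nat \<Rightarrow> real) \<Rightarrow> (nat \<Rightarrow> real) \<Rightarrow> bool" (infix "\<preceq>" 50) where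
  "h \<preceq> f \<longleftrightarrow>
     (\<exists>K M N :: nat. K > 0 \<and> M > 0 \<and> (\<forall>n\<ge>N. h n \<le> real K * f (M * n)))"

definition growth_much_less :: "(nat \<Rightarrow> real) \<Rightarrow> (nat \<Rightarrow> real) \<Rightarrow> bool" (infix "\<lless>" 50) where
  "h \<lless> f \<longleftrightarrow>
     (\<exists>N. \<exists>t \<in> growth_functions N. \<not> bdd_above (t ` {N..}) \<and> (\<lambda>n. h n * t n) \<preceq> f)"

section \<open>Fellow traveler property\<close>

text \<open>The prefix \<open>w(t)\<close> is \<open>take t w\<close>. The maximum is over a set of numbers at most \<open>2 * n\<close>,
  which is nonempty as soon as \<open>A\<close> is nonempty and \<open>L\<close> is a normal form.\<close>

definition traveler_function ::
    "('g, 'm) monoid_scheme \<Rightarrow> 's set \<Rightarrow> ('s \<Rightarrow> 'g) \<Rightarrow> 's letter list set \<Rightarrow> nat \<Rightarrow> real" where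
  "traveler_function G A \<iota> L n =
     real (Max {word_dist G A \<iota> (eval_word G \<iota> (take t w1)) (eval_word G \<iota> (take t w2)) | t w1 w2 a.
        t \<le> n \<and> w1 \<in> L \<and> w2 \<in> L \<and> a \<in> A \<and> eval_word G \<iota> w1 \<otimes>\<^bsub>G\<^esub> \<iota> a = eval_word G \<iota> w2})"

definition fellow_traveler_property ::
    "('g, 'm) monoid_scheme \<Rightarrow> 's set \<Rightarrow> ('s \<Rightarrow> 'g) \<Rightarrow> 's letter list set \<Rightarrow> (nat \<Rightarrow> real) \<Rightarrow> bool" where
  "fellow_traveler_property G A \<iota> L f \<longleftrightarrow>
     (\<exists>N. f \<in> growth_functions N) \<and> f \<lless> (\<lambda>n. real n) \<and> traveler_function G A \<iota> L \<preceq> f"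

section \<open>Automatic and Cayley automatic groups\<close>

definition automatic ::
    "('g, 'm) monoid_scheme \<Rightarrow> 's set \<Rightarrow> ('s \<Rightarrow> 'g) \<Rightarrow> bool" where
  "automatic G A \<iota> \<longleftrightarrow>
     (\<exists>L. normal_form G A \<iota> L \<and> regular_language (letters A) L \<and>
        (\<forall>a\<in>A. synchronously_recognized (letters A)
           {(u, v). u \<in> L \<and> v \<in> L \<and> eval_word G \<iota> u \<otimes>\<^bsub>G\<^esub> \<iota> a = eval_word G \<iota> v}))"

definition cayley_automatic_representation ::
    "('g, 'm) monoid_scheme \<Rightarrow> 's set \<Rightarrow> ('s \<Rightarrow> 'g) \<Rightarrow>
     's letter list set \<Rightarrow> ('s letter list \<Rightarrow> 'g) \<Rightarrow> bool" where
  "cayley_automatic_representation G A \<iota> L \<psi> \<longleftrightarrow>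
     L \<subseteq> lists (letters A) \<and> regular_language (letters A) L \<and>
     bij_betw \<psi> L (carrier G) \<and>
     (\<forall>a\<in>A. synchronously_recognized (letters A)
        {(u, v). u \<in> L \<and> v \<in> L \<and> \<psi> u \<otimes>\<^bsub>G\<^esub> \<iota> a = \<psi> v})"

definition cayley_distance ::
    "('g, 'm) monoid_scheme \<Rightarrow> 's set \<Rightarrow> ('s \<Rightarrow> 'g) \<Rightarrow>
     's letter list set \<Rightarrow> ('s letter list \<Rightarrow> 'g) \<Rightarrow> nat \<Rightarrow> real" where
  "cayley_distance G A \<iota> L \<psi> n =
     (let L_n = {w \<in> L. length w \<le> n} in
      if L_n = {} then 0
      else real (Max ((\<lambda>w. word_dist G A \<iota> (\<psi> w) (eval_word G \<iota> w)) ` L_n)))"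

end

theory Submission imports Defs begin

text \<open>
  The normal form is obtained from \<open>L\<close> by correcting each word at its end. A word \<open>w\<close> in \<open>L\<close>
  represents \<open>\<psi> w\<close> only up to an error: its evaluation \<open>\<pi> w\<close> may be another group element, at
  distance at most \<open>h (length w)\<close>. Appending a shortest word that leads from \<open>\<pi> w\<close> to \<open>\<psi> w\<close>
  gives a word whose evaluation is exactly \<open>\<psi> w\<close>, and these corrected words form \<open>L'\<close>
  (\<open>corrected_word\<close>). They are a normal form since \<open>\<psi>\<close> is a bijection.

  Both metric properties rest on one observation about automata
  (\<open>synchronously_recognized_completion\<close>): a prefix of an accepted word can be completed to an
  accepted word by a suffix whose length is bounded by a constant, because how it can be
  completed depends only on the state that is reached.

  For the length estimate, consider words \<open>u, v\<close> in \<open>L\<close> with \<open>\<psi> v = \<psi> u \<cdot> a\<close> for a generator \<open>a\<close>.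
  Cutting the pair at time \<open>length u\<close> and completing it without lengthening \<open>u\<close> must return
  \<open>v\<close> itself, as \<open>u\<close> determines \<open>v\<close>. So \<open>v\<close> is longer than \<open>u\<close> by at most a constant, and hence the length of the
  representative of \<open>g\<close> grows at most linearly in the distance of \<open>g\<close> from the identity.
  The length of the correction is of the same order, by the triangle inequality.

  For the fellow traveler property, cut both words of such a pair at time \<open>t\<close> and complete the
  two prefixes simultaneously to a pair that is again related by \<open>a\<close>. The completed words have
  length at most \<open>t + c\<close>, they represent neighbours in \<open>G\<close> via \<open>\<psi>\<close>, and their evaluations
  are within \<open>h (t + c)\<close> of what they represent. So the prefixes, and
  then also the prefixes of the corrected words, are at distance at most
  \<open>4 * h (n + c) + 2 * c + 1\<close> for \<open>t \<le> n\<close>.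

  It remains to absorb the additive constant, and this is where it matters that the group is not
  automatic: if \<open>h\<close> vanished identically then \<open>\<psi>\<close> would be the evaluation map and
  \<open>L\<close> itself would witness automaticity. So \<open>h\<close> is eventually at least \<open>1\<close>.
\<close>

section \<open>Completing prefixes in regular languages\<close>

lemma finite_uniform_bound:
  fixes P :: "'b \<Rightarrow> nat \<Rightarrow> bool"
  assumes "finite B" "\<And>b. b \<in> B \<Longrightarrow> \<exists>c. P b c"
    and mono: "\<And>b c c'. P b c \<Longrightarrow> c \<le> c' \<Longrightarrow> P b c'"
  shows "\<exists>c. \<forall>b\<in>B. P b c"
  using assms(1,2)
proof (induction B rule: finite_induct)
  case empty then show ?case by simp
next
  case (insert b B)
  then obtain c1 c2 where c1: "P b c1" and c2: "\<forall>b\<in>B. P b c2" by (meson insertI1 insertI2)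
  have "\<forall>b'\<in>insert b B. P b' (max c1 c2)"
    using mono[OF c1, of "max c1 c2"] c2 mono[of _ c2 "max c1 c2"] by auto
  then show ?case by (rule exI)
qed

text \<open>Whether a prefix has a completion with property \<open>P\<close> depends only on the state reached
  after reading it, so it suffices to fix one completion for each of the finitely many states.\<close>

lemma regular_language_completion:
  assumes "regular_language \<Sigma> L"
  shows "\<exists>c. \<forall>u v. u @ v \<in> L \<longrightarrow> P v \<longrightarrow> (\<exists>v'. length v' \<le> c \<and> P v' \<and> u @ v' \<in> L)"
proof -
  obtain Q :: "nat set" and q0 F \<delta> where "finite Q" "q0 \<in> Q"
    and \<delta>: "\<And>q x. q \<in> Q \<Longrightarrow> x \<in> \<Sigma> \<Longrightarrow> \<delta> q x \<in> Q"
    and L: "L = {w \<in> lists \<Sigma>. foldl \<delta> q0 w \<in> F}"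
    using assms unfolding regular_language_def by blast
  define good where "good q v \<longleftrightarrow> v \<in> lists \<Sigma> \<and> P v \<and> foldl \<delta> q v \<in> F" for q v
  define s where "s q = (SOME v. good q v)" for q
  have "finite ((\<lambda>q. length (s q)) ` Q)" using \<open>finite Q\<close> by simp
  then obtain c where c: "\<And>q. q \<in> Q \<Longrightarrow> length (s q) \<le> c"
    unfolding finite_nat_set_iff_bounded_le by blast
  have reach: "foldl \<delta> q u \<in> Q" if "u \<in> lists \<Sigma>" "q \<in> Q" for q u
    using that by (induction u arbitrary: q) (auto simp: \<delta>)
  have "\<exists>v'. length v' \<le> c \<and> P v' \<and> u @ v' \<in> L" if uv: "u @ v \<in> L" "P v" for u v
  proof -
    let ?q = "foldl \<delta> q0 u"
    have "u \<in> lists \<Sigma>" "good ?q v"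
      using uv by (auto simp: L good_def)
    then have "good ?q (s ?q)" unfolding s_def by (metis someI)
    then show ?thesis
      using c[OF reach[OF \<open>u \<in> lists \<Sigma>\<close> \<open>q0 \<in> Q\<close>]] \<open>u \<in> lists \<Sigma>\<close>
      by (auto simp: L good_def intro!: exI[of _ "s ?q"])
  qed
  then show ?thesis by blast
qed

lemma take_convolution: "take t (convolution u v) = convolution (take t u) (take t v)"
  by (induction u v arbitrary: t rule: convolution.induct) (auto simp: take_Cons split: nat.splits)

lemma drop_convolution: "drop t (convolution u v) = convolution (drop t u) (drop t v)"
  by (induction u v arbitrary: t rule: convolution.induct) (auto simp: drop_Cons split: nat.splits)

lemma convolution_swap: "convolution v u = map prod.swap (convolution u v)"
  by (induction u v rule: convolution.induct) auto

text \<open>Deleting the padding recovers the two words from their convolution. Unlike the convolution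
  itself, this commutes with concatenation, so it shows how both words change when a prefix of
  their convolution is continued differently.\<close>

definition fst_track :: "('b option \<times> 'b option) list \<Rightarrow> 'b list" where
  "fst_track z = List.map_filter fst z"

definition snd_track :: "('b option \<times> 'b option) list \<Rightarrow> 'b list" where
  "snd_track z = List.map_filter snd z"

lemma track_append [simp]:
  "fst_track (y @ z) = fst_track y @ fst_track z"
  "snd_track (y @ z) = snd_track y @ snd_track z"
  by (simp_all add: fst_track_def snd_track_def List.map_filter_def)

lemma track_convolution [simp]:
  "fst_track (convolution u v) = u"
  "snd_track (convolution u v) = v"
  by (induction u v rule: convolution.induct)
    (auto simp: fst_track_def snd_track_def List.map_filter_simps)

lemma length_track_le:
  "length (fst_track z) \<le> length z"
  "length (snd_track z) \<le> length z"
  by (simp_all add: fst_track_def snd_track_def List.map_filter_def)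

text \<open>Both words are cut at the same time and completed simultaneously. The property \<open>P\<close>
  allows one to insist that a first word which has already ended is not extended.\<close>

lemma synchronously_recognized_completion:
  assumes "synchronously_recognized \<Sigma> R"
  shows "\<exists>c. \<forall>u v t. (u, v) \<in> R \<longrightarrow> P (drop t u) \<longrightarrow>
    (\<exists>x y. length x \<le> c \<and> length y \<le> c \<and> P x \<and> (take t u @ x, take t v @ y) \<in> R)"
proof -
  let ?C = "{convolution u v | u v. (u, v) \<in> R}"
  obtain c where c: "\<And>y z. y @ z \<in> ?C \<Longrightarrow> P (fst_track z) \<Longrightarrow>
      \<exists>z'. length z' \<le> c \<and> P (fst_track z') \<and> y @ z' \<in> ?C"
    using regular_language_completion[of _ ?C "\<lambda>z. P (fst_track z)"] assms
    unfolding synchronously_recognized_def by meson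
  have "\<exists>x y. length x \<le> c \<and> length y \<le> c \<and> P x \<and> (take t u @ x, take t v @ y) \<in> R"
    if R: "(u, v) \<in> R" and P: "P (drop t u)" for u v t
  proof -
    have "take t (convolution u v) @ drop t (convolution u v) \<in> ?C"
      unfolding append_take_drop_id using R by blast
    moreover have "P (fst_track (drop t (convolution u v)))"
      using P by (simp add: drop_convolution)
    ultimately obtain z where z: "length z \<le> c" "P (fst_track z)"
        "take t (convolution u v) @ z \<in> ?C"
      using c by blast
    then obtain u' v' where R': "(u', v') \<in> R"
      and eq: "convolution (take t u) (take t v) @ z = convolution u' v'"
      by (auto simp: take_convolution)
    have "u' = take t u @ fst_track z" "v' = take t v @ snd_track z"
      using arg_cong[OF eq, of fst_track] arg_cong[OF eq, of snd_track] by simp_all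
    with R' z show ?thesis
      by (meson length_track_le le_trans)
  qed
  then show ?thesis by blast
qed

lemma regular_language_vimage_map:
  assumes "regular_language \<Sigma> C" and f: "\<And>x. f x \<in> \<Sigma> \<longleftrightarrow> x \<in> \<Sigma>"
  shows "regular_language \<Sigma> (map f -` C)"
proof -
  obtain Q :: "nat set" and q0 F \<delta> where fin: "finite Q" "q0 \<in> Q" "F \<subseteq> Q"
    and \<delta>: "\<And>q x. q \<in> Q \<Longrightarrow> x \<in> \<Sigma> \<Longrightarrow> \<delta> q x \<in> Q"
    and C: "C = {w \<in> lists \<Sigma>. foldl \<delta> q0 w \<in> F}"
    using assms(1) unfolding regular_language_def by blast
  define \<delta>' where "\<delta>' q x = \<delta> q (f x)" for q x
  have "foldl \<delta>' q w = foldl \<delta> q (map f w)" for q w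
    by (induction w arbitrary: q) (simp_all add: \<delta>'_def)
  then have "map f -` C = {w \<in> lists \<Sigma>. foldl \<delta>' q0 w \<in> F}"
    by (auto simp: C f)
  moreover have "\<forall>q\<in>Q. \<forall>x\<in>\<Sigma>. \<delta>' q x \<in> Q"
    using \<delta> f by (simp add: \<delta>'_def)
  ultimately show ?thesis
    unfolding regular_language_def using fin by blast
qed

lemma synchronously_recognized_converse:
  assumes "synchronously_recognized \<Sigma> R"
  shows "synchronously_recognized \<Sigma> (R\<inverse>)"
proof -
  let ?C = "{convolution u v | u v. (u, v) \<in> R}"
  let ?D = "{convolution u v | u v. (u, v) \<in> R\<inverse>}"
  have "w \<in> ?D \<longleftrightarrow> map prod.swap w \<in> ?C" for w
  proof
    assume "w \<in> ?D"
    then obtain u v where "(v, u) \<in> R" "w = convolution u v" by blast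
    moreover from this(2) have "map prod.swap w = convolution v u"
      using convolution_swap[of v u] by (simp only:)
    ultimately show "map prod.swap w \<in> ?C" by blast
  next
    assume "map prod.swap w \<in> ?C"
    then obtain u v where uv: "(u, v) \<in> R" "map prod.swap w = convolution u v" by blast
    have "w = map prod.swap (map prod.swap w)" by (simp add: o_def)
    also have "\<dots> = convolution v u"
      unfolding uv(2) by (rule convolution_swap[symmetric])
    finally show "w \<in> ?D" using uv(1) by blast
  qed
  then have D: "?D = map prod.swap -` ?C"
    by (simp only: set_eq_iff vimage_eq simp_thms)
  have "prod.swap x \<in> padded_pairs \<Sigma> \<longleftrightarrow> x \<in> padded_pairs \<Sigma>" for x
    by (cases x) (auto simp: padded_pairs_def)
  with assms show ?thesis
    unfolding synchronously_recognized_def D by (rule regular_language_vimage_map)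
qed

text \<open>If \<open>v\<close> is longer than \<open>u\<close>, the part of \<open>v\<close> beyond \<open>u\<close> can be exchanged for a
  short one; as \<open>u\<close> determines \<open>v\<close>, that part was already short.\<close>

lemma synchronously_recognized_function_length:
  assumes "synchronously_recognized \<Sigma> R" "single_valued R"
  shows "\<exists>c. \<forall>u v. (u, v) \<in> R \<longrightarrow> length v \<le> length u + c"
proof -
  obtain c where c: "\<And>u v t. (u, v) \<in> R \<Longrightarrow> drop t u = [] \<Longrightarrow>
      \<exists>x y. length x \<le> c \<and> length y \<le> c \<and> x = [] \<and> (take t u @ x, take t v @ y) \<in> R"
    using synchronously_recognized_completion[OF assms(1), of "\<lambda>x. x = []"] by meson
  have "length v \<le> length u + c" if R: "(u, v) \<in> R" for u v
  proof -
    obtain y where "length y \<le> c" "(u, take (length u) v @ y) \<in> R"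
      using c[OF R, of "length u"] by auto
    moreover from this R have "v = take (length u) v @ y"
      using assms(2) by (blast dest: single_valuedD)
    ultimately show ?thesis
      by (metis add_mono length_append length_take min.cobounded2)
  qed
  then show ?thesis by blast
qed

section \<open>The word metric of a marked group\<close>

locale marked_group = group G for G (structure) +
  fixes A :: "'s set" and \<iota> :: "'s \<Rightarrow> 'a"
  assumes marking_closed: "\<iota> \<in> A \<rightarrow> carrier G"
    and marking_generates: "generate G (\<iota> ` A) = carrier G"
begin

abbreviation \<pi> :: "'s letter list \<Rightarrow> 'a" where "\<pi> \<equiv> eval_word G \<iota>"
abbreviation words :: "'s letter list set" where "words \<equiv> lists (letters A)"
abbreviation d :: "'a \<Rightarrow> 'a \<Rightarrow> nat" where "d \<equiv> word_dist G A \<iota>"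

lemma marking_mem [simp]: "a \<in> A \<Longrightarrow> \<iota> a \<in> carrier G"
  using marking_closed by blast

lemma eval_letter_closed [simp]: "x \<in> letters A \<Longrightarrow> eval_letter G \<iota> x \<in> carrier G"
  by (auto simp: letters_def)

lemma eval_word_Nil [simp]: "\<pi> [] = \<one>"
  by (simp add: eval_word_def)

lemma eval_word_Cons [simp]: "\<pi> (x # w) = eval_letter G \<iota> x \<otimes> \<pi> w"
  by (simp add: eval_word_def)

lemma eval_word_closed [simp]: "w \<in> words \<Longrightarrow> \<pi> w \<in> carrier G"
  by (induction w) auto

lemma eval_word_append: "u \<in> words \<Longrightarrow> v \<in> words \<Longrightarrow> \<pi> (u @ v) = \<pi> u \<otimes> \<pi> v"
  by (induction u) (auto simp: m_assoc)

lemma eval_word_surj: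
  assumes "g \<in> carrier G" shows "\<exists>u\<in>words. \<pi> u = g"
proof -
  have "g \<in> generate G (\<iota> ` A)" using assms marking_generates by simp
  then show ?thesis
  proof (induction g rule: generate.induct)
    case one then show ?case by (auto intro: bexI[of _ "[]"])
  next
    case (incl h)
    then obtain a where "a \<in> A" "h = \<iota> a" by blast
    then show ?case by (intro bexI[of _ "[Gen a]"]) (auto simp: letters_def)
  next
    case (inv h)
    then obtain a where "a \<in> A" "h = \<iota> a" by blast
    then show ?case by (intro bexI[of _ "[Inv a]"]) (auto simp: letters_def)
  next
    case (eng h1 h2)
    then obtain u v where "u \<in> words" "\<pi> u = h1" "v \<in> words" "\<pi> v = h2" by blast
    then show ?case by (intro bexI[of _ "u @ v"]) (auto simp: eval_word_append)
  qed
qed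

lemma word_dist_geodesic:
  assumes "g \<in> carrier G" "h \<in> carrier G"
  obtains u where "u \<in> words" "length u = d g h" "g \<otimes> \<pi> u = h"
proof -
  let ?P = "\<lambda>n. \<exists>u\<in>words. length u = n \<and> \<pi> u = inv g \<otimes> h"
  obtain w where "w \<in> words" "\<pi> w = inv g \<otimes> h"
    using eval_word_surj[of "inv g \<otimes> h"] assms by auto
  then have "?P (length w)" by blast
  then have "?P (d g h)" unfolding word_dist_def by (rule LeastI)
  then obtain u where "u \<in> words" "length u = d g h" "\<pi> u = inv g \<otimes> h" by blast
  moreover from this have "g \<otimes> \<pi> u = h" using assms by (simp flip: m_assoc)
  ultimately show thesis using that by blast
qed

lemma word_dist_le:
  assumes "g \<in> carrier G" "u \<in> words" "g \<otimes> \<pi> u = h"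
  shows "d g h \<le> length u"
proof -
  have "\<pi> u = inv g \<otimes> h" using assms by (metis eval_word_closed inv_solve_left m_closed)
  then show ?thesis unfolding word_dist_def using assms(2) by (blast intro: Least_le)
qed

lemma word_dist_triangle:
  assumes "g \<in> carrier G" "h \<in> carrier G" "k \<in> carrier G"
  shows "d g k \<le> d g h + d h k"
proof -
  obtain u v where u: "u \<in> words" "length u = d g h" "g \<otimes> \<pi> u = h"
    and v: "v \<in> words" "length v = d h k" "h \<otimes> \<pi> v = k"
    by (meson assms word_dist_geodesic)
  have "g \<otimes> \<pi> (u @ v) = k"
    using u v assms by (simp add: eval_word_append m_assoc[symmetric])
  then have "d g k \<le> length (u @ v)"
    using assms u v by (intro word_dist_le) auto
  then show ?thesis using u v by simp
qed

lemma eval_word_inverse: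
  "u \<in> words \<Longrightarrow> \<exists>v\<in>words. length v = length u \<and> \<pi> v = inv (\<pi> u)"
proof (induction u)
  case Nil then show ?case by auto
next
  case (Cons x u)
  then have x: "x \<in> letters A" and "u \<in> words" by auto
  with Cons.IH obtain v where v: "v \<in> words" "length v = length u" "\<pi> v = inv (\<pi> u)" by blast
  obtain y where y: "y \<in> letters A" "eval_letter G \<iota> y = inv (eval_letter G \<iota> x)"
  proof (cases x)
    case (Gen a) then show thesis using x that[of "Inv a"] by (auto simp: letters_def)
  next
    case (Inv a) then show thesis using x that[of "Gen a"] by (auto simp: letters_def)
  qed
  have "\<pi> (v @ [y]) = inv (\<pi> (x # u))"
    using v y x \<open>u \<in> words\<close> by (simp add: eval_word_append inv_mult_group)
  then show ?case using v y by (intro bexI[of _ "v @ [y]"]) auto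
qed

lemma word_dist_commute:
  assumes "g \<in> carrier G" "h \<in> carrier G" shows "d g h = d h g"
proof -
  have le: "d k g \<le> d g k" if gk: "g \<in> carrier G" "k \<in> carrier G" for g k
  proof -
    obtain u where u: "u \<in> words" "length u = d g k" "g \<otimes> \<pi> u = k"
      by (rule word_dist_geodesic[OF gk])
    obtain v where v: "v \<in> words" "length v = length u" "\<pi> v = inv (\<pi> u)"
      using eval_word_inverse u by blast
    have "k \<otimes> \<pi> v = g"
      using eval_word_closed[OF u(1)] u(3)[symmetric] v(3) gk by (simp add: m_assoc)
    then show ?thesis using word_dist_le[of k v g] gk u v by simp
  qed
  show ?thesis using le assms by (meson le_antisym)
qed

lemma word_dist_eq_0D:
  assumes "g \<in> carrier G" "h \<in> carrier G" "d g h = 0" shows "g = h"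
  using word_dist_geodesic[OF assms(1,2)] assms by auto

lemma word_dist_eval_append:
  assumes "u \<in> words" "v \<in> words" shows "d (\<pi> u) (\<pi> (u @ v)) \<le> length v"
  using assms by (intro word_dist_le) (auto simp: eval_word_append)

lemma word_dist_marking:
  assumes "g \<in> carrier G" "a \<in> A" shows "d g (g \<otimes> \<iota> a) \<le> 1"
  using word_dist_le[of g "[Gen a]"] assms by (auto simp: letters_def)

end

section \<open>Cayley automatic representations\<close>

text \<open>As \<open>A\<close> is finite, there are only finitely many words of bounded length, so the maximum
  in the Cayley distance function is attained.\<close>

lemma
  fixes \<psi> :: "'s letter list \<Rightarrow> 'g"
  assumes "finite A" "L \<subseteq> lists (letters A)"
  shows cayley_distance_upper: "\<And>w n. w \<in> L \<Longrightarrow> length w \<le> n \<Longrightarrow>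
      real (word_dist G A \<iota> (\<psi> w) (eval_word G \<iota> w)) \<le> cayley_distance G A \<iota> L \<psi> n"
    and cayley_distance_mono: "mono (cayley_distance G A \<iota> L \<psi>)"
    and cayley_distance_nat: "\<And>n. \<exists>k::nat. cayley_distance G A \<iota> L \<psi> n = real k"
proof -
  let ?f = "\<lambda>w. word_dist G A \<iota> (\<psi> w) (eval_word G \<iota> w)"
  let ?L = "\<lambda>n. {w \<in> L. length w \<le> n}"
  have "finite (letters A)" using assms(1) by (simp add: letters_def)
  then have fin: "finite (?L n)" for n
    by (rule finite_subset[rotated, OF finite_lists_length_le[of _ n]]) (use assms(2) in auto)
  show upper: "real (?f w) \<le> cayley_distance G A \<iota> L \<psi> n" if "w \<in> L" "length w \<le> n" for w n
    using that fin[of n] by (auto simp: cayley_distance_def Let_def)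
  show nat: "\<exists>k::nat. cayley_distance G A \<iota> L \<psi> n = real k" for n
    unfolding cayley_distance_def Let_def by (metis of_nat_0)
  show "mono (cayley_distance G A \<iota> L \<psi>)"
  proof
    fix m n :: nat assume "m \<le> n"
    show "cayley_distance G A \<iota> L \<psi> m \<le> cayley_distance G A \<iota> L \<psi> n"
    proof (cases "?L m = {}")
      case True
      then have "cayley_distance G A \<iota> L \<psi> m = 0" by (simp add: cayley_distance_def)
      then show ?thesis using nat[of n] by auto
    next
      case False
      then have "Max (?f ` ?L m) \<in> ?f ` ?L m" using fin by (intro Max_in) auto
      then obtain w where w: "w \<in> ?L m" "Max (?f ` ?L m) = ?f w" by blast
      then have "cayley_distance G A \<iota> L \<psi> m = real (?f w)"
        using False by (simp only: cayley_distance_def Let_def if_False)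
      also have "\<dots> \<le> cayley_distance G A \<iota> L \<psi> n"
        using w \<open>m \<le> n\<close> by (intro upper) auto
      finally show ?thesis .
    qed
  qed
qed

locale cayley_automatic_group = marked_group G A \<iota> for G (structure) and A :: "'s set" and \<iota> +
  fixes L :: "'s letter list set" and \<psi> :: "'s letter list \<Rightarrow> 'a"
  assumes finite_generators: "finite A"
    and representation: "cayley_automatic_representation G A \<iota> L \<psi>"
begin

abbreviation h :: "nat \<Rightarrow> real" where "h \<equiv> cayley_distance G A \<iota> L \<psi>"

definition rel :: "'s \<Rightarrow> ('s letter list \<times> 's letter list) set" where
  "rel a = {(u, v). u \<in> L \<and> v \<in> L \<and> \<psi> u \<otimes> \<iota> a = \<psi> v}"

lemma L_words: "w \<in> L \<Longrightarrow> w \<in> words"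
  and bij: "bij_betw \<psi> L (carrier G)"
  and sync: "a \<in> A \<Longrightarrow> synchronously_recognized (letters A) (rel a)"
  using representation unfolding cayley_automatic_representation_def rel_def by auto

lemma L_subset: "L \<subseteq> words" using L_words by blast

lemma psi_closed [simp]: "w \<in> L \<Longrightarrow> \<psi> w \<in> carrier G"
  using bij by (auto simp: bij_betw_def)

definition rep :: "'a \<Rightarrow> 's letter list" where "rep = inv_into L \<psi>"

lemma rep_mem: "g \<in> carrier G \<Longrightarrow> rep g \<in> L"
  and psi_rep [simp]: "g \<in> carrier G \<Longrightarrow> \<psi> (rep g) = g"
  using bij unfolding rep_def
  by (auto simp: bij_betw_def inv_into_into f_inv_into_f)

lemma rep_words [simp]: "g \<in> carrier G \<Longrightarrow> rep g \<in> words"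
  using rep_mem L_words by blast

lemma rep_rel: "g \<in> carrier G \<Longrightarrow> a \<in> A \<Longrightarrow> (rep g, rep (g \<otimes> \<iota> a)) \<in> rel a"
  by (simp add: rel_def rep_mem)

lemma h_upper: "w \<in> L \<Longrightarrow> length w \<le> n \<Longrightarrow> real (d (\<psi> w) (\<pi> w)) \<le> h n"
  by (rule cayley_distance_upper[OF finite_generators L_subset])

lemma h_mono: "m \<le> n \<Longrightarrow> h m \<le> h n"
  using cayley_distance_mono[OF finite_generators L_subset] by (rule monoD)

lemma h_nat: "\<exists>k::nat. h n = real k"
  by (rule cayley_distance_nat[OF finite_generators L_subset])

text \<open>Both \<open>\<psi>\<close> and right multiplication by \<open>\<iota> a\<close> are bijections, so \<open>rel a\<close> is single-valued in both
  directions; the converse direction handles right multiplication by \<open>inv (\<iota> a)\<close>.\<close>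

lemma rel_length:
  assumes "a \<in> A"
  shows "\<exists>c. \<forall>u v. (u, v) \<in> rel a \<longrightarrow> length v \<le> length u + c \<and> length u \<le> length v + c"
proof -
  have "inj_on \<psi> L" using bij by (simp add: bij_betw_def)
  then have "single_valued (rel a)" "single_valued ((rel a)\<inverse>)"
    using assms
    by (auto simp: single_valued_def rel_def inj_on_def) (metis psi_closed marking_mem right_cancel)
  then obtain c1 c2 where c1: "\<And>u v. (u, v) \<in> rel a \<Longrightarrow> length v \<le> length u + c1"
    and c2: "\<And>u v. (u, v) \<in> (rel a)\<inverse> \<Longrightarrow> length v \<le> length u + c2"
    using synchronously_recognized_function_length[OF sync[OF assms]]
      synchronously_recognized_function_length[OF
        synchronously_recognized_converse[OF sync[OF assms]]]
    by blast
  have "length v \<le> length u + (c1 + c2) \<and> length u \<le> length v + (c1 + c2)"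
    if "(u, v) \<in> rel a" for u v
    using c1[OF that] c2[of v u] that by simp
  then show ?thesis by blast
qed

lemma rep_length_step:
  "\<exists>c. \<forall>g\<in>carrier G. \<forall>x\<in>letters A. length (rep (g \<otimes> eval_letter G \<iota> x)) \<le> length (rep g) + c"
proof -
  have "\<exists>m. \<forall>a\<in>A. \<forall>u v. (u, v) \<in> rel a \<longrightarrow>
      length v \<le> length u + m \<and> length u \<le> length v + m"
    by (rule finite_uniform_bound[OF finite_generators rel_length])
      (assumption, meson add_left_mono le_trans)
  then obtain m where m: "length v \<le> length u + m" "length u \<le> length v + m"
    if "a \<in> A" "(u, v) \<in> rel a" for a u v
    by metis
  have "length (rep (g \<otimes> eval_letter G \<iota> x)) \<le> length (rep g) + m"
    if g: "g \<in> carrier G" and x: "x \<in> letters A" for g x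
  proof (cases x)
    case (Gen a)
    with x have a: "a \<in> A" by (auto simp: letters_def)
    show ?thesis using m(1)[OF a rep_rel[OF g a]] by (simp add: Gen)
  next
    case (Inv a)
    with x have a: "a \<in> A" by (auto simp: letters_def)
    let ?k = "g \<otimes> inv (\<iota> a)"
    \<comment> \<open>The edge \<open>a\<close> leads from \<open>?k\<close> to \<open>g\<close> and is traversed backwards.\<close>
    have "?k \<otimes> \<iota> a = g" using g a by (simp add: m_assoc)
    then have "(rep ?k, rep g) \<in> rel a" using rep_rel[of ?k a] a g by simp
    then show ?thesis using m(2)[OF a] by (simp add: Inv)
  qed
  then show ?thesis by blast
qed

lemma rep_length_linear:
  "\<exists>b c. \<forall>g\<in>carrier G. length (rep g) \<le> b + c * d \<one> g"
proof -
  obtain c where c: "\<And>g x. g \<in> carrier G \<Longrightarrow> x \<in> letters A \<Longrightarrow>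
      length (rep (g \<otimes> eval_letter G \<iota> x)) \<le> length (rep g) + c"
    using rep_length_step by blast
  have walk: "length (rep (g \<otimes> \<pi> w)) \<le> length (rep g) + c * length w"
    if "g \<in> carrier G" "w \<in> words" for g w
    using that
  proof (induction w arbitrary: g)
    case (Cons x w)
    then have *: "x \<in> letters A" "w \<in> words" by auto
    have "length (rep (g \<otimes> \<pi> (x # w))) = length (rep (g \<otimes> eval_letter G \<iota> x \<otimes> \<pi> w))"
      using Cons.prems * by (simp add: m_assoc)
    also have "\<dots> \<le> length (rep (g \<otimes> eval_letter G \<iota> x)) + c * length w"
      using Cons.IH Cons.prems * by simp
    also have "\<dots> \<le> length (rep g) + c * length (x # w)"
      using c[OF Cons.prems(1) *(1)] by simp
    finally show ?case .
  qed simp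
  have "length (rep g) \<le> length (rep \<one>) + c * d \<one> g" if "g \<in> carrier G" for g
  proof -
    obtain u where "u \<in> words" "length u = d \<one> g" "\<one> \<otimes> \<pi> u = g"
      by (rule word_dist_geodesic[OF one_closed \<open>g \<in> carrier G\<close>])
    then show ?thesis using walk[of \<one> u] that by simp
  qed
  then show ?thesis by blast
qed

section \<open>The corrected normal form\<close>

definition correction :: "'a \<Rightarrow> 's letter list" where
  "correction g = (SOME u. u \<in> words \<and> length u = d (\<pi> (rep g)) g \<and> \<pi> (rep g) \<otimes> \<pi> u = g)"

definition corrected_word :: "'a \<Rightarrow> 's letter list" where
  "corrected_word g = rep g @ correction g"

lemma
  assumes "g \<in> carrier G"
  shows correction_words [simp]: "correction g \<in> words"
    and length_correction: "length (correction g) = d (\<pi> (rep g)) g"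
    and eval_correction: "\<pi> (rep g) \<otimes> \<pi> (correction g) = g"
proof -
  have "\<exists>u. u \<in> words \<and> length u = d (\<pi> (rep g)) g \<and> \<pi> (rep g) \<otimes> \<pi> u = g"
    using word_dist_geodesic[of "\<pi> (rep g)" g] assms by (metis eval_word_closed rep_words)
  from someI_ex[OF this, folded correction_def]
  show "correction g \<in> words" "length (correction g) = d (\<pi> (rep g)) g"
    "\<pi> (rep g) \<otimes> \<pi> (correction g) = g" by auto
qed

lemma corrected_word_words [simp]: "g \<in> carrier G \<Longrightarrow> corrected_word g \<in> words"
  using rep_words[of g] correction_words[of g] by (simp add: corrected_word_def)

lemma eval_corrected_word [simp]: "g \<in> carrier G \<Longrightarrow> \<pi> (corrected_word g) = g"
  by (simp add: corrected_word_def eval_word_append eval_correction)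

lemma length_correction_le_h: "g \<in> carrier G \<Longrightarrow> real (length (correction g)) \<le> h (length (rep g))"
  using h_upper[OF rep_mem order_refl, of g] by (simp add: length_correction word_dist_commute)

lemma normal_form_corrected: "normal_form G A \<iota> (corrected_word ` carrier G)"
  unfolding normal_form_def
  using corrected_word_words by (intro conjI image_subsetI)
    (simp_all add: bij_betw_def inj_on_def image_image)

text \<open>A linear bound on \<open>length (rep g)\<close> is enough: the correction leads from \<open>\<pi> (rep g)\<close>
  to \<open>g\<close>, so a detour through the identity bounds its length by \<open>length (rep g) + d \<one> g\<close>.\<close>

lemma quasigeodesic_corrected: "quasigeodesic G A \<iota> (corrected_word ` carrier G)"
proof -
  obtain b c where bc: "\<And>g. g \<in> carrier G \<Longrightarrow> length (rep g) \<le> b + c * d \<one> g"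
    using rep_length_linear by blast
  define C where "C = 2 * b + 2 * c + 1"
  have "length (corrected_word g) \<le> C * (d \<one> g + 1)" if g: "g \<in> carrier G" for g
  proof -
    have "d (\<pi> (rep g)) \<one> \<le> length (rep g)"
      using word_dist_eval_append[of "[]" "rep g"] g by (simp add: word_dist_commute)
    then have "length (correction g) \<le> length (rep g) + d \<one> g"
      using word_dist_triangle[of "\<pi> (rep g)" \<one> g] g by (simp add: length_correction)
    then have "length (corrected_word g) \<le> 2 * (b + c * d \<one> g) + d \<one> g"
      using bc[OF g] by (simp add: corrected_word_def)
    then show ?thesis by (simp add: C_def algebra_simps)
  qed
  then have "real (length (corrected_word g)) \<le> real (C * (d \<one> g + 1))"
    if "g \<in> carrier G" for g
    using that by (simp only: of_nat_le_iff)
  then have "real (length (corrected_word g)) \<le> real C * (real (d \<one> g) + 1)"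
    if "g \<in> carrier G" for g
    using that by (simp add: algebra_simps)
  moreover have "real C > 0" by (simp add: C_def)
  ultimately show ?thesis
    unfolding quasigeodesic_def by (intro exI[of _ "real C"]) auto
qed

text \<open>If the cut falls into the correction, then \<open>rep g\<close> has length at most \<open>t\<close> and the part
  of the correction that has been read has length at most \<open>h t\<close>.\<close>

lemma take_corrected_word_dist:
  assumes g: "g \<in> carrier G"
  shows "real (d (\<pi> (take t (rep g))) (\<pi> (take t (corrected_word g)))) \<le> h t"
proof -
  let ?v = "take (t - length (rep g)) (correction g)"
  have w: "take t (rep g) \<in> words" "?v \<in> words"
    using rep_words[OF g] correction_words[OF g] by (auto dest: in_set_takeD)
  have "d (\<pi> (take t (rep g))) (\<pi> (take t (corrected_word g))) \<le> length ?v"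
    using word_dist_eval_append[OF w] by (simp add: corrected_word_def)
  moreover have "real (length ?v) \<le> h t"
  proof (cases "length (rep g) \<le> t")
    case True
    then have "h (length (rep g)) \<le> h t" by (rule h_mono)
    then show ?thesis using length_correction_le_h[OF g] by simp
  next
    case False then show ?thesis using h_nat[of t] by auto
  qed
  ultimately show ?thesis by linarith
qed

lemma rel_completion:
  "\<exists>c. \<forall>a\<in>A. \<forall>u v t. (u, v) \<in> rel a \<longrightarrow>
    (\<exists>x y. length x \<le> c \<and> length y \<le> c \<and> (take t u @ x, take t v @ y) \<in> rel a)"
proof (rule finite_uniform_bound[OF finite_generators])
  show "\<exists>c. \<forall>u v t. (u, v) \<in> rel a \<longrightarrow>
      (\<exists>x y. length x \<le> c \<and> length y \<le> c \<and> (take t u @ x, take t v @ y) \<in> rel a)"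
    if "a \<in> A" for a
    using synchronously_recognized_completion[OF sync[OF that], of "\<lambda>_. True"] by simp
qed (meson le_trans)

text \<open>Between the two cut points lies a path through \<open>G\<close>: from the corrected prefix to the
  prefix of the representative, on to its completion in \<open>L\<close>, to the element which that
  represents, across the edge \<open>a\<close>, and back in the same way. Four of the seven legs are
  controlled by \<open>h\<close>, the other three by constants.\<close>

lemma traveler_bound:
  "\<exists>c. \<forall>n t g a. t \<le> n \<longrightarrow> g \<in> carrier G \<longrightarrow> a \<in> A \<longrightarrow>
    real (d (\<pi> (take t (corrected_word g))) (\<pi> (take t (corrected_word (g \<otimes> \<iota> a)))))
      \<le> 4 * h (n + c) + 2 * real c + 1"
proof -
  obtain c where c: "\<forall>a\<in>A. \<forall>u v t. (u, v) \<in> rel a \<longrightarrow>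
      (\<exists>x y. length x \<le> c \<and> length y \<le> c \<and> (take t u @ x, take t v @ y) \<in> rel a)"
    using rel_completion ..
  have "real (d (\<pi> (take t (corrected_word g))) (\<pi> (take t (corrected_word (g \<otimes> \<iota> a)))))
      \<le> 4 * h (n + c) + 2 * real c + 1"
    if t: "t \<le> n" and g: "g \<in> carrier G" and a: "a \<in> A" for n t g a
  proof -
    let ?k = "g \<otimes> \<iota> a"
    have k: "?k \<in> carrier G" using g a by simp
    obtain x y where xy: "length x \<le> c" "length y \<le> c"
      and R: "(take t (rep g) @ x, take t (rep ?k) @ y) \<in> rel a"
      using c[rule_format, OF a rep_rel[OF g a]] by blast
    define p1 p2 where p: "p1 = take t (rep g)" "p2 = take t (rep ?k)"
    define q1 q2 where q: "q1 = p1 @ x" "q2 = p2 @ y"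
    have L: "q1 \<in> L" "q2 \<in> L" and edge: "\<psi> q2 = \<psi> q1 \<otimes> \<iota> a"
      using R by (simp_all add: rel_def p q)
    have words: "p1 \<in> words" "x \<in> words" "p2 \<in> words" "y \<in> words"
      using L[THEN L_words] by (auto simp: q)
    have cut: "take t (corrected_word g) \<in> words" "take t (corrected_word ?k) \<in> words"
      using corrected_word_words[OF g] corrected_word_words[OF k] by (auto dest: in_set_takeD)
    let ?g1 = "\<pi> (take t (corrected_word g))" and ?g2 = "\<pi> (take t (corrected_word ?k))"
    have cl: "?g1 \<in> carrier G" "?g2 \<in> carrier G" "\<pi> p1 \<in> carrier G" "\<pi> p2 \<in> carrier G"
      "\<pi> q1 \<in> carrier G" "\<pi> q2 \<in> carrier G" "\<psi> q1 \<in> carrier G" "\<psi> q2 \<in> carrier G"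
      using words L cut L_words by auto
    have len: "length q1 \<le> n + c" "length q2 \<le> n + c"
      using xy t by (auto simp: p q)
    have "h t \<le> h (n + c)" using h_mono t by simp
    then have ends: "real (d ?g1 (\<pi> p1)) \<le> h (n + c)" "real (d (\<pi> p2) ?g2) \<le> h (n + c)"
      using take_corrected_word_dist[OF g, of t] take_corrected_word_dist[OF k, of t] cl
      by (auto simp: p word_dist_commute)
    have complete: "d (\<pi> p1) (\<pi> q1) \<le> c" "d (\<pi> q2) (\<pi> p2) \<le> c"
      using word_dist_eval_append words xy cl by (auto simp: q word_dist_commute intro: le_trans)
    have error: "real (d (\<pi> q1) (\<psi> q1)) \<le> h (n + c)" "real (d (\<psi> q2) (\<pi> q2)) \<le> h (n + c)"
      using h_upper L len cl by (auto simp: word_dist_commute)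
    have neighbours: "d (\<psi> q1) (\<psi> q2) \<le> 1"
      unfolding edge using word_dist_marking cl a by blast
    have "d ?g1 ?g2 \<le> d ?g1 (\<pi> p1) + d (\<pi> p1) (\<pi> q1) + d (\<pi> q1) (\<psi> q1) + d (\<psi> q1) (\<psi> q2)
        + d (\<psi> q2) (\<pi> q2) + d (\<pi> q2) (\<pi> p2) + d (\<pi> p2) ?g2"
      using word_dist_triangle[of ?g1 "\<pi> p1" ?g2] word_dist_triangle[of "\<pi> p1" "\<pi> q1" ?g2]
        word_dist_triangle[of "\<pi> q1" "\<psi> q1" ?g2] word_dist_triangle[of "\<psi> q1" "\<psi> q2" ?g2]
        word_dist_triangle[of "\<psi> q2" "\<pi> q2" ?g2] word_dist_triangle[of "\<pi> q2" "\<pi> p2" ?g2] cl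
      by linarith
    with ends complete error neighbours show ?thesis by linarith
  qed
  then show ?thesis by blast
qed

text \<open>As \<open>h\<close> is monotone and takes natural values, it suffices that it does not vanish
  everywhere. Were \<open>h\<close> identically zero, \<open>\<psi>\<close> would agree with evaluation on \<open>L\<close>, and \<open>L\<close> with the
  given automata would be an automatic structure.\<close>

lemma h_eventually_ge_1:
  assumes "\<not> automatic G A \<iota>"
  shows "\<exists>N. \<forall>n\<ge>N. 1 \<le> h n"
proof -
  have "\<exists>N. h N \<noteq> 0"
  proof (rule ccontr)
    assume "\<nexists>N. h N \<noteq> 0"
    then have "\<pi> w = \<psi> w" if "w \<in> L" for w
      using h_upper[OF that order_refl] that L_words word_dist_eq_0D[of "\<psi> w" "\<pi> w"] by auto
    then have "bij_betw \<pi> L (carrier G)"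
      and "rel a = {(u, v). u \<in> L \<and> v \<in> L \<and> \<pi> u \<otimes> \<iota> a = \<pi> v}" for a
      using bij by (auto simp: rel_def cong: bij_betw_cong)
    then have "automatic G A \<iota>"
      using sync representation unfolding automatic_def normal_form_def
      by (intro exI[of _ L]) (auto simp: cayley_automatic_representation_def)
    with assms show False ..
  qed
  then obtain N where "h N \<noteq> 0" by blast
  then have "1 \<le> h N" using h_nat[of N] by auto
  then have "1 \<le> h n" if "n \<ge> N" for n
    using h_mono that by (meson order_trans)
  then show ?thesis by blast
qed

lemma traveler_function_corrected:
  assumes "\<not> automatic G A \<iota>" "A \<noteq> {}"
  shows "traveler_function G A \<iota> (corrected_word ` carrier G) \<preceq> h"
proof -
  obtain c where c: "\<And>n t g a. t \<le> n \<Longrightarrow> g \<in> carrier G \<Longrightarrow> a \<in> A \<Longrightarrow>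
    real (d (\<pi> (take t (corrected_word g))) (\<pi> (take t (corrected_word (g \<otimes> \<iota> a)))))
      \<le> 4 * h (n + c) + 2 * real c + 1"
    using traveler_bound by blast
  obtain N where N: "\<And>n. n \<ge> N \<Longrightarrow> 1 \<le> h n"
    using h_eventually_ge_1[OF assms(1)] by blast
  let ?L' = "corrected_word ` carrier G"
  have "traveler_function G A \<iota> ?L' n \<le> real (2 * c + 5) * h (2 * n)" if n: "n \<ge> max N c" for n
  proof -
    let ?X = "{d (\<pi> (take t w1)) (\<pi> (take t w2)) | t w1 w2 a.
      t \<le> n \<and> w1 \<in> ?L' \<and> w2 \<in> ?L' \<and> a \<in> A \<and> \<pi> w1 \<otimes> \<iota> a = \<pi> w2}"
    \<comment> \<open>The bound is needed before the maximum can be used: it also shows that the set is finite.\<close>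
    have le: "real k \<le> 4 * h (n + c) + 2 * real c + 1" if "k \<in> ?X" for k
      using that by (auto intro: c)
    then have "k \<le> nat \<lceil>4 * h (n + c) + 2 * real c + 1\<rceil>" if "k \<in> ?X" for k
      using that by (meson real_nat_ceiling_ge of_nat_le_iff order_trans)
    then have "finite ?X" unfolding finite_nat_set_iff_bounded_le by blast
    moreover obtain a where a: "a \<in> A" using assms(2) by blast
    \<comment> \<open>Time \<open>0\<close> on the edge \<open>a\<close> at the identity shows that the set is nonempty.\<close>
    have "d (\<pi> (take 0 (corrected_word \<one>))) (\<pi> (take 0 (corrected_word (\<iota> a)))) \<in> ?X"
      using a by (intro CollectI exI[of _ "corrected_word \<one>"] exI[of _ "corrected_word (\<iota> a)"]
        exI[of _ "0::nat"] exI[of _ a]) auto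
    then have "?X \<noteq> {}" by blast
    ultimately have "Max ?X \<in> ?X" by (rule Max_in)
    then have "traveler_function G A \<iota> ?L' n \<le> 4 * h (n + c) + 2 * real c + 1"
      unfolding traveler_function_def by (rule le)
    also have "h (n + c) \<le> h (2 * n)" using h_mono n by simp
    \<comment> \<open>The constant is absorbed because \<open>h (2 * n)\<close> is at least \<open>1\<close>.\<close>
    also have "4 * h (2 * n) + 2 * real c + 1 \<le> real (2 * c + 5) * h (2 * n)"
    proof -
      have "(2 * real c + 1) * 1 \<le> (2 * real c + 1) * h (2 * n)"
        using N[of "2 * n"] n by (intro mult_left_mono) auto
      then show ?thesis by (simp add: algebra_simps)
    qed
    finally show ?thesis by simp
  qed
  then show ?thesis
    unfolding growth_le_def
    by (intro exI[of _ "2 * c + 5"] exI[of _ "2::nat"] exI[of _ "max N c"]) auto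
qed

lemma h_growth_function: "h \<in> growth_functions 0"
  using h_mono h_nat unfolding growth_functions_def
  by (auto simp: monotone_on_def) (metis of_nat_0_le_iff)

end

theorem theorem16:
  fixes G :: "('g, 'm) monoid_scheme"
    and A :: "'s set"
    and \<iota> :: "'s \<Rightarrow> 'g"
    and L :: "'s letter list set"
    and \<psi> :: "'s letter list \<Rightarrow> 'g"
  assumes "group G"
    and "infinite (carrier G)"
    and "finite A"
    and "\<iota> \<in> A \<rightarrow> carrier G"
    and "generate G (\<iota> ` A) = carrier G"
    and "\<not> automatic G A \<iota>"
    and "cayley_automatic_representation G A \<iota> L \<psi>"
    and "cayley_distance G A \<iota> L \<psi> \<lless> (\<lambda>n. real n)"
  shows "\<exists>L'. normal_form G A \<iota> L' \<and> quasigeodesic G A \<iota> L' \<and>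
           fellow_traveler_property G A \<iota> L' (cayley_distance G A \<iota> L \<psi>)"
proof -
  interpret group G by fact
  interpret cayley_automatic_group G A \<iota> L \<psi>
    by unfold_locales fact+
  have "A \<noteq> {}"
  proof
    assume "A = {}"
    then have "carrier G = {\<one>\<^bsub>G\<^esub>}" using assms(5) generate_empty by simp
    then show False using assms(2) by simp
  qed
  then have "fellow_traveler_property G A \<iota> (corrected_word ` carrier G) h"
    unfolding fellow_traveler_property_def
    using h_growth_function assms(6,8) traveler_function_corrected by blast
  then show ?thesis
    using normal_form_corrected quasigeodesic_corrected by blast
qed

end
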